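(* Let $d\ge2$. The following statements hold: (1) $\mathcal{S}_1^d$ is a closed subset of $(\mathcal{S}_{rc}^d,d_{AW^r})$. In particular, $(\mathcal{S}_1^d,d_{AW^r})$ is complete. (2) $\mathcal{S}_{rc,b}^d$ is an open subset of $(\mathcal{S}_{rc}^d,d_{AW^r})$. (3) $d_{AW^r}$ and $\delta$ generate the same topology on $\mathcal{S}_{rc,b}^d$.
   Context: $\mathbb{N}=\{1,2,\dots\}$; $B_2^d$ and $\mathbb{S}^{d-1}$ are the closed Euclidean unit ball and the unit sphere of $\mathbb{R}^d$. A star set is a non-empty $A\subseteq\mathbb{R}^d$ with $ta\in A$ for all $a\in A$, $0\le t\le 1$. Its radial function is $\rho_A:\mathbb{S}^{d-1}\to[0,\infty]$, $\rho_A(\theta)=\sup\{\lambda\ge 0:\lambda\theta\in A\}$. A star body is a star set $A$ that is radially closed: $\rho_A(\theta)\theta\in A$ whenever $\rho_A(\theta)<\infty$; it need not be closed or bounded. $\mathcal{S}_{rc}^d$ is the family of all star bodies in $\mathbb{R}^d$, $\mathcal{S}_{rc,b}^d$ the subfamily of bounded ones, and $\mathcal{S}_1^d$ the subfamily of star bodies with continuous radial function $\rho_A:\mathbb{S}^{d-1}\to[0,\infty]$. The radial sum $A_1\tilde{+}A_2$ is the star body with radial function $\rho_{A_1}+\rho_{A_2}$. The radial distance is $d_r(x,A)=\inf\{\alpha>0: x\in A\tilde{+}\alpha B_2^d\}$, $x\in\mathbb{R}^d$, $A\in\mathcal{S}_{rc}^d$. The radial Attouch-Wets distance is the metric on $\mathcal{S}_{rc}^d$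 given by $d_{AW^r}(A_1,A_2)=\sup_{j\in\mathbb{N}}\min\{\frac1j,\sup_{\|x\|\le j}|d_r(x,A_1)-d_r(x,A_2)|\}$. The radial metric on bounded star bodies is $\delta(A_1,A_2)=\sup_{\theta\in\mathbb{S}^{d-1}}|\rho_{A_1}(\theta)-\rho_{A_2}(\theta)|$. *)

theory Defs
  imports "HOL-Analysis.Analysis"
begin

definition star_set :: "'a::euclidean_space set \<Rightarrow> bool" where
  "star_set A \<longleftrightarrow> A \<noteq> {} \<and> (\<forall>a\<in>A. \<forall>t. 0 \<le> t \<and> t \<le> 1 \<longrightarrow> t *\<^sub>R a \<in> A)"

text \<open>Radial functions take values in \<open>[0,\<infinity>]\<close>, represented by the type \<^typ>\<open>ennreal\<close>
  with its order topology. They are only meaningful on the unit sphere.\<close>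

definition radial_fun :: "'a::euclidean_space set \<Rightarrow> 'a \<Rightarrow> ennreal" where
  "radial_fun A \<theta> = Sup {ennreal l |l. 0 \<le> l \<and> l *\<^sub>R \<theta> \<in> A}"

definition radially_closed :: "'a::euclidean_space set \<Rightarrow> bool" where
  "radially_closed A \<longleftrightarrow>
     (\<forall>\<theta>\<in>sphere 0 1. radial_fun A \<theta> < \<infinity> \<longrightarrow> enn2real (radial_fun A \<theta>) *\<^sub>R \<theta> \<in> A)"

definition star_bodies :: "'a::euclidean_space set set" where
  "star_bodies = {A. star_set A \<and> radially_closed A}"

definition bounded_star_bodies :: "'a::euclidean_space set set" where
  "bounded_star_bodies = {A \<in> star_bodies. bounded A}"

definition continuous_star_bodies :: "'a::euclidean_space set set" where
  "continuous_star_bodies = {A \<in> star_bodies. continuous_on (sphere 0 1) (radial_fun A)}"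

text \<open>Existence and uniqueness of the radial sum are shown in \<open>ex1_radial_sum\<close> below.\<close>

definition radial_sum :: "'a::euclidean_space set \<Rightarrow> 'a set \<Rightarrow> 'a set" where
  "radial_sum A B = (THE C. C \<in> star_bodies \<and>
     (\<forall>\<theta>\<in>sphere 0 1. radial_fun C \<theta> = radial_fun A \<theta> + radial_fun B \<theta>))"

definition radial_infdist :: "'a::euclidean_space \<Rightarrow> 'a set \<Rightarrow> real" where
  "radial_infdist x A = Inf {\<alpha>. 0 < \<alpha> \<and> x \<in> radial_sum A ((\<lambda>y. \<alpha> *\<^sub>R y) ` cball 0 1)}"

text \<open>The suprema are taken in the reals; all the sets involved are bounded above, since
  \<open>0 \<le> radial_infdist x A \<le> norm x\<close> for star bodies (see \<open>radial_infdist_bounds\<close>).\<close>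

definition dist_AWr :: "'a::euclidean_space set \<Rightarrow> 'a set \<Rightarrow> real" where
  "dist_AWr A B = (SUP j\<in>{1::nat..}.
     min (1 / real j) (SUP x\<in>cball 0 (real j). \<bar>radial_infdist x A - radial_infdist x B\<bar>))"

text \<open>The radial functions of bounded star bodies are bounded by a real, so neither
  \<^const>\<open>enn2real\<close> nor the real supremum loses information. Outside the bounded star bodies
  the value is irrelevant; it is set to 0 because the locale \<^locale>\<open>Metric_space\<close> asks for
  nonnegativity and symmetry off the carrier as well.\<close>

definition radial_dist :: "'a::euclidean_space set \<Rightarrow> 'a set \<Rightarrow> real" where
  "radial_dist A B =
     (if A \<in> bounded_star_bodies \<and> B \<in> bounded_star_bodies
      then SUP \<theta>\<in>sphere 0 1. \<bar>enn2real (radial_fun A \<theta>) - enn2real (radial_fun B \<theta>)\<bar>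
      else 0)"


subsection \<open>Well-definedness\<close>

lemma mem_star_body_iff:
  assumes A: "A \<in> star_bodies" and th: "\<theta> \<in> sphere 0 1" and l: "0 \<le> l"
  shows "l *\<^sub>R \<theta> \<in> A \<longleftrightarrow> ennreal l \<le> radial_fun A \<theta>"
proof
  assume "l *\<^sub>R \<theta> \<in> A"
  then show "ennreal l \<le> radial_fun A \<theta>"
    unfolding radial_fun_def using l by (intro Sup_upper) auto
next
  assume le: "ennreal l \<le> radial_fun A \<theta>"
  have scale: "l *\<^sub>R \<theta> \<in> A" if m: "m *\<^sub>R \<theta> \<in> A" "l \<le> m" for m
  proof (cases "m = 0")
    case True
    then show ?thesis using m l by auto
  next
    case False
    then have "0 \<le> l / m" "l / m \<le> 1" using m l by auto
    then have "(l / m) *\<^sub>R (m *\<^sub>R \<theta>) \<in> A"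
      using A m(1) unfolding star_bodies_def star_set_def by blast
    then show ?thesis using False by simp
  qed
  show "l *\<^sub>R \<theta> \<in> A"
  proof (cases "radial_fun A \<theta> < \<infinity>")
    case True
    then have "enn2real (radial_fun A \<theta>) *\<^sub>R \<theta> \<in> A"
      using A th unfolding star_bodies_def radially_closed_def by auto
    moreover have "l \<le> enn2real (radial_fun A \<theta>)"
      using enn2real_mono[OF le] True l by (simp add: less_top)
    ultimately show ?thesis by (rule scale)
  next
    case False
    then have "ennreal l < radial_fun A \<theta>" by (simp add: less_top[symmetric])
    then obtain m where "0 \<le> m" "m *\<^sub>R \<theta> \<in> A" "ennreal l < ennreal m"
      unfolding radial_fun_def less_Sup_iff by auto
    then show ?thesis using scale by (simp add: ennreal_less_iff l)
  qed
qed

lemma zero_in_star_body: "A \<in> star_bodies \<Longrightarrow> 0 \<in> A"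
  unfolding star_bodies_def star_set_def by fastforce

lemma mem_star_body_sgn:
  assumes "A \<in> star_bodies"
  shows "x \<in> A \<longleftrightarrow> x = 0 \<or> ennreal (norm x) \<le> radial_fun A (sgn x)"
proof (cases "x = 0")
  case False
  then have "sgn x \<in> sphere 0 1" by (simp add: norm_sgn)
  from mem_star_body_iff[OF assms this norm_ge_zero[of x]] show ?thesis
    using False by (simp add: sgn_div_norm)
qed (use zero_in_star_body[OF assms] in auto)

lemma ex_star_body:
  fixes f :: "'a::euclidean_space \<Rightarrow> ennreal"
  shows "\<exists>C\<in>star_bodies. \<forall>\<theta>\<in>sphere 0 1. radial_fun C \<theta> = f \<theta>"
proof -
  define C where "C = {x. x = 0 \<or> ennreal (norm x) \<le> f (sgn x)}"
  have mem: "l *\<^sub>R \<theta> \<in> C \<longleftrightarrow> ennreal l \<le> f \<theta>" if "\<theta> \<in> sphere 0 1" "0 \<le> l" for l \<theta>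
    using that by (cases "l = 0") (auto simp: C_def sgn_scaleR sgn_div_norm)
  have rf: "radial_fun C \<theta> = f \<theta>" if th: "\<theta> \<in> sphere 0 1" for \<theta>
  proof (rule antisym)
    show "radial_fun C \<theta> \<le> f \<theta>"
      unfolding radial_fun_def using mem[OF th] by (auto intro!: Sup_least)
    show "f \<theta> \<le> radial_fun C \<theta>"
    proof (rule dense_le)
      fix y assume y: "y < f \<theta>"
      then obtain l where l: "y = ennreal l" "0 \<le> l"
        by (cases y) auto
      then have "l *\<^sub>R \<theta> \<in> C" using mem[OF th] y by auto
      then show "y \<le> radial_fun C \<theta>"
        unfolding radial_fun_def using l by (intro Sup_upper) auto
    qed
  qed
  have "star_set C"
    unfolding star_set_def
  proof (intro conjI ballI allI impI)
    show "C \<noteq> {}" by (auto simp: C_def)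
    fix a and t :: real assume a: "a \<in> C" and t: "0 \<le> t \<and> t \<le> 1"
    show "t *\<^sub>R a \<in> C"
    proof (cases "t = 0 \<or> a = 0")
      case False
      then have "ennreal (norm a) \<le> f (sgn a)" using a by (auto simp: C_def)
      moreover have "ennreal (norm (t *\<^sub>R a)) \<le> ennreal (norm a)"
        using t by (intro ennreal_leI) (auto simp: mult_left_le_one_le)
      ultimately have "ennreal (norm (t *\<^sub>R a)) \<le> f (sgn a)" by order
      then show ?thesis
        using False t by (simp add: C_def sgn_scaleR)
    qed (auto simp: C_def)
  qed
  moreover have "radially_closed C"
    unfolding radially_closed_def
  proof (intro ballI impI)
    fix \<theta> :: 'a assume th: "\<theta> \<in> sphere 0 1" and "radial_fun C \<theta> < \<infinity>"
    then show "enn2real (radial_fun C \<theta>) *\<^sub>R \<theta> \<in> C"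
      by (subst mem[OF th]) (auto simp: rf[OF th] less_top)
  qed
  ultimately show ?thesis using rf unfolding star_bodies_def by blast
qed

lemma ex1_radial_sum:
  fixes A B :: "'a::euclidean_space set"
  shows "\<exists>!C. C \<in> star_bodies \<and>
     (\<forall>\<theta>\<in>sphere 0 1. radial_fun C \<theta> = radial_fun A \<theta> + radial_fun B \<theta>)"
proof (rule ex_ex1I)
  show "\<exists>C. C \<in> star_bodies \<and>
     (\<forall>\<theta>\<in>sphere 0 1. radial_fun C \<theta> = radial_fun A \<theta> + radial_fun B \<theta>)"
    using ex_star_body[of "\<lambda>\<theta>. radial_fun A \<theta> + radial_fun B \<theta>"] by blast
  fix C D :: "'a set"
  assume C: "C \<in> star_bodies \<and>
     (\<forall>\<theta>\<in>sphere 0 1. radial_fun C \<theta> = radial_fun A \<theta> + radial_fun B \<theta>)"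
    and D: "D \<in> star_bodies \<and>
     (\<forall>\<theta>\<in>sphere 0 1. radial_fun D \<theta> = radial_fun A \<theta> + radial_fun B \<theta>)"
  have "x \<in> C \<longleftrightarrow> x \<in> D" for x
    using mem_star_body_sgn[of C x] mem_star_body_sgn[of D x] C D
    by (cases "x = 0") (auto simp: norm_sgn)
  then show "C = D" by blast
qed

lemma
  shows radial_sum_star_body: "radial_sum A B \<in> star_bodies"
    and radial_fun_radial_sum: "\<theta> \<in> sphere 0 1 \<Longrightarrow>
      radial_fun (radial_sum A B) \<theta> = radial_fun A \<theta> + radial_fun B \<theta>"
  using theI'[OF ex1_radial_sum[of A B]] unfolding radial_sum_def[symmetric] by auto

lemma radial_fun_ball:
  assumes "0 < \<alpha>" and th: "\<theta> \<in> sphere 0 1"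
  shows "radial_fun ((\<lambda>y. \<alpha> *\<^sub>R y) ` cball 0 1) \<theta> = ennreal \<alpha>"
proof -
  have "(\<lambda>y. \<alpha> *\<^sub>R y) ` cball 0 1 = (cball 0 \<alpha> :: 'a set)"
    using cball_scale[of \<alpha> 0 1] assms by auto
  then show ?thesis
    unfolding radial_fun_def using assms
    by (intro antisym Sup_least Sup_upper) (auto intro!: ennreal_leI)
qed

lemma mem_radial_sum_ball:
  assumes "0 < \<alpha>"
  shows "x \<in> radial_sum A ((\<lambda>y. \<alpha> *\<^sub>R y) ` cball 0 1) \<longleftrightarrow>
     x = 0 \<or> ennreal (norm x) \<le> radial_fun A (sgn x) + ennreal \<alpha>"
  using assms
  by (cases "x = 0")
    (auto simp: mem_star_body_sgn[OF radial_sum_star_body] radial_fun_radial_sum radial_fun_ball norm_sgn)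

lemma radial_infdist_bounds: "0 \<le> radial_infdist x A" "radial_infdist x A \<le> norm x"
proof -
  let ?S = "{\<alpha>. 0 < \<alpha> \<and> x \<in> radial_sum A ((\<lambda>y. \<alpha> *\<^sub>R y) ` cball 0 1)}"
  have mem: "\<alpha> \<in> ?S" if "norm x < \<alpha>" for \<alpha>
  proof -
    have "0 < \<alpha>" using that norm_ge_zero[of x] by linarith
    moreover have "ennreal (norm x) \<le> radial_fun A (sgn x) + ennreal \<alpha>"
      using that by (intro add_increasing ennreal_leI) auto
    ultimately show ?thesis by (simp add: mem_radial_sum_ball)
  qed
  have bdd: "bdd_below ?S" by (rule bdd_belowI[of _ 0]) auto
  show "0 \<le> radial_infdist x A"
    unfolding radial_infdist_def using mem[of "norm x + 1"] by (intro cInf_greatest) auto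
  show "radial_infdist x A \<le> norm x"
    unfolding radial_infdist_def
    by (rule field_le_epsilon, rule cInf_lower[OF mem bdd]) auto
qed

lemma radial_infdist_eq_0_iff:
  assumes A: "A \<in> star_bodies"
  shows "radial_infdist x A = 0 \<longleftrightarrow> x \<in> A"
proof
  assume "x \<in> A"
  then have "x = 0 \<or> ennreal (norm x) \<le> radial_fun A (sgn x) + ennreal \<alpha>" for \<alpha>
    unfolding mem_star_body_sgn[OF A] by (metis add_increasing2 zero_le)
  then have "{\<alpha>. 0 < \<alpha> \<and> x \<in> radial_sum A ((\<lambda>y. \<alpha> *\<^sub>R y) ` cball 0 1)} = {0<..}"
    using mem_radial_sum_ball by blast
  then show "radial_infdist x A = 0" by (simp add: radial_infdist_def)
next
  assume 0: "radial_infdist x A = 0"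
  let ?S = "{\<alpha>. 0 < \<alpha> \<and> x \<in> radial_sum A ((\<lambda>y. \<alpha> *\<^sub>R y) ` cball 0 1)}"
  have ne: "?S \<noteq> {}"
  proof -
    have "ennreal (norm x) \<le> radial_fun A (sgn x) + ennreal (norm x + 1)"
      by (rule add_increasing[OF zero_le ennreal_leI]) simp
    moreover have "0 < norm x + 1" using norm_ge_zero[of x] by linarith
    ultimately have "norm x + 1 \<in> ?S"
      using mem_radial_sum_ball[of "norm x + 1" x A] by blast
    then show ?thesis by blast
  qed
  show "x \<in> A"
    unfolding mem_star_body_sgn[OF A]
  proof (cases "x = 0")
    case False
    have "ennreal (norm x) \<le> radial_fun A (sgn x)"
    proof (rule ennreal_le_epsilon)
      fix e :: real assume e: "0 < e"
      then have "Inf ?S < e" using 0 by (simp add: radial_infdist_def)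
      then obtain \<alpha> where a: "\<alpha> \<in> ?S" "\<alpha> < e"
        using cInf_lessD[OF ne] by blast
      then have "ennreal (norm x) \<le> radial_fun A (sgn x) + ennreal \<alpha>"
        using False mem_radial_sum_ball[of \<alpha> x A] by auto
      also have "\<dots> \<le> radial_fun A (sgn x) + ennreal e"
        using a by (intro add_left_mono ennreal_leI) auto
      finally show "ennreal (norm x) \<le> radial_fun A (sgn x) + ennreal e" .
    qed
    then show "x = 0 \<or> ennreal (norm x) \<le> radial_fun A (sgn x)" ..
  qed simp
qed

lemma SUP_abs_diff_triangle:
  fixes f g h :: "'b \<Rightarrow> real"
  assumes "S \<noteq> {}" and fg: "bdd_above ((\<lambda>x. \<bar>f x - g x\<bar>) ` S)"
    and gh: "bdd_above ((\<lambda>x. \<bar>g x - h x\<bar>) ` S)"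
  shows "(SUP x\<in>S. \<bar>f x - h x\<bar>) \<le> (SUP x\<in>S. \<bar>f x - g x\<bar>) + (SUP x\<in>S. \<bar>g x - h x\<bar>)"
proof (rule cSUP_least[OF assms(1)])
  fix x assume x: "x \<in> S"
  have "\<bar>f x - h x\<bar> \<le> \<bar>f x - g x\<bar> + \<bar>g x - h x\<bar>" by linarith
  also have "\<dots> \<le> (SUP x\<in>S. \<bar>f x - g x\<bar>) + (SUP x\<in>S. \<bar>g x - h x\<bar>)"
    by (intro add_mono cSUP_upper x fg gh)
  finally show "\<bar>f x - h x\<bar> \<le> (SUP x\<in>S. \<bar>f x - g x\<bar>) + (SUP x\<in>S. \<bar>g x - h x\<bar>)" .
qed

lemma bdd_above_radial_infdist_diff:
  "bdd_above ((\<lambda>x. \<bar>radial_infdist x A - radial_infdist x B\<bar>) ` cball 0 r)"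
proof (rule bdd_aboveI2)
  fix x :: 'a assume "x \<in> cball 0 r"
  then show "\<bar>radial_infdist x A - radial_infdist x B\<bar> \<le> r"
    using radial_infdist_bounds[of x A] radial_infdist_bounds[of x B] by auto
qed

lemma Metric_space_dist_AWr: "Metric_space (star_bodies :: 'a::euclidean_space set set) dist_AWr"
proof -
  define D where "D j A B = (SUP x\<in>cball 0 (real j). \<bar>radial_infdist x A - radial_infdist x B\<bar>)"
    for j and A B :: "'a set"
  have upper: "\<bar>radial_infdist x A - radial_infdist x B\<bar> \<le> D j A B"
    if "norm x \<le> real j" for x j and A B :: "'a set"
    unfolding D_def using that by (intro cSUP_upper bdd_above_radial_infdist_diff) auto
  have D0: "0 \<le> D j A B" for j and A B :: "'a set"
    using upper[of 0 j A B] by simp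
  have bdd: "bdd_above ((\<lambda>j. min (1 / real j) (D j A B)) ` {1..})" for A B :: "'a set"
    by (rule bdd_aboveI2[of _ _ 1]) (auto simp: min_le_iff_disj)
  have eq: "dist_AWr A B = (SUP j\<in>{1::nat..}. min (1 / real j) (D j A B))" for A B :: "'a set"
    by (simp add: dist_AWr_def D_def)
  have le: "min (1 / real j) (D j A B) \<le> dist_AWr A B" if "1 \<le> j" for j and A B :: "'a set"
    unfolding eq using that by (intro cSUP_upper bdd) auto
  have nonneg: "0 \<le> dist_AWr A B" for A B :: "'a set"
    using le[of 1 A B] D0[of 1 A B] by (auto simp: min_def split: if_splits)
  show ?thesis
  proof
    fix A B C :: "'a set"
    show "0 \<le> dist_AWr A B" by (rule nonneg)
    show "dist_AWr A B = dist_AWr B A"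
      by (simp add: dist_AWr_def abs_minus_commute)
    show "dist_AWr A B = 0 \<longleftrightarrow> A = B" if AB: "A \<in> star_bodies" "B \<in> star_bodies"
    proof
      assume "A = B"
      then show "dist_AWr A B = 0"
        by (simp add: dist_AWr_def)
    next
      assume 0: "dist_AWr A B = 0"
      have "radial_infdist x A = radial_infdist x B" for x
      proof -
        obtain n where n: "norm x \<le> real n" using real_arch_simple by blast
        define j where "j = Suc n"
        have j: "1 \<le> j" "norm x \<le> real j" using n by (auto simp: j_def)
        have "D j A B \<le> 0"
          using le[OF j(1), of A B] 0 j(1) by (auto simp: min_le_iff_disj)
        then show ?thesis using upper[OF j(2), of A B] by linarith
      qed
      then show "A = B"
        by (intro set_eqI) (simp flip: radial_infdist_eq_0_iff[OF AB(1)] radial_infdist_eq_0_iff[OF AB(2)])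
    qed
    show "dist_AWr A C \<le> dist_AWr A B + dist_AWr B C"
      unfolding eq[of A C]
    proof (rule cSUP_least)
      fix j :: nat assume "j \<in> {1..}"
      then have j: "1 \<le> j" by simp
      have "D j A C \<le> D j A B + D j B C"
        unfolding D_def
        by (rule SUP_abs_diff_triangle[OF _ bdd_above_radial_infdist_diff bdd_above_radial_infdist_diff]) simp
      then have "min (1 / real j) (D j A C) \<le> min (1 / real j) (D j A B) + min (1 / real j) (D j B C)"
        using D0[of j A B] D0[of j B C] divide_nonneg_nonneg[of 1 "real j"]
        unfolding min_def by (smt (verit) of_nat_0_le_iff)
      also have "\<dots> \<le> dist_AWr A B + dist_AWr B C"
        by (intro add_mono le j)
      finally show "min (1 / real j) (D j A C) \<le> dist_AWr A B + dist_AWr B C" .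
    qed simp
  qed
qed

lemma bounded_star_body_radial_fun:
  assumes "A \<in> bounded_star_bodies"
  obtains R where "0 \<le> R" "\<And>\<theta>. \<theta> \<in> sphere 0 1 \<Longrightarrow> radial_fun A \<theta> \<le> ennreal R"
proof -
  obtain R where R: "\<And>x. x \<in> A \<Longrightarrow> norm x \<le> R"
    using assms unfolding bounded_star_bodies_def bounded_iff by auto
  have "radial_fun A \<theta> \<le> ennreal (max 0 R)" if "\<theta> \<in> sphere 0 1" for \<theta>
    unfolding radial_fun_def using that R
    by (fastforce intro!: Sup_least ennreal_leI)
  then show ?thesis using that[of "max 0 R"] by simp
qed

lemma Metric_space_radial_dist:
  "Metric_space (bounded_star_bodies :: 'a::euclidean_space set set) radial_dist"
proof -
  have ne: "(sphere 0 1 :: 'a set) \<noteq> {}" by (simp add: sphere_eq_empty)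
  have bdd: "bdd_above ((\<lambda>\<theta>. \<bar>enn2real (radial_fun A \<theta>) - enn2real (radial_fun B \<theta>)\<bar>) ` sphere 0 1)"
    if AB: "A \<in> bounded_star_bodies" "B \<in> bounded_star_bodies" for A B :: "'a set"
  proof -
    obtain R where R: "0 \<le> R" "\<And>\<theta>. \<theta> \<in> sphere 0 1 \<Longrightarrow> radial_fun A \<theta> \<le> ennreal R"
      using bounded_star_body_radial_fun[OF AB(1)] by blast
    obtain Q where Q: "0 \<le> Q" "\<And>\<theta>. \<theta> \<in> sphere 0 1 \<Longrightarrow> radial_fun B \<theta> \<le> ennreal Q"
      using bounded_star_body_radial_fun[OF AB(2)] by blast
    show ?thesis
    proof (rule bdd_aboveI2)
      fix \<theta> :: 'a assume th: "\<theta> \<in> sphere 0 1"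
      have "enn2real (radial_fun A \<theta>) \<le> R" "enn2real (radial_fun B \<theta>) \<le> Q"
        using R Q th by (auto intro!: enn2real_leI)
      then show "\<bar>enn2real (radial_fun A \<theta>) - enn2real (radial_fun B \<theta>)\<bar> \<le> R + Q"
        using enn2real_nonneg[of "radial_fun A \<theta>"] enn2real_nonneg[of "radial_fun B \<theta>"] by linarith
    qed
  qed
  have upper: "\<bar>enn2real (radial_fun A \<theta>) - enn2real (radial_fun B \<theta>)\<bar> \<le> radial_dist A B"
    if "A \<in> bounded_star_bodies" "B \<in> bounded_star_bodies" "\<theta> \<in> sphere 0 1" for A B :: "'a set" and \<theta>
    using that by (auto simp: radial_dist_def intro!: cSUP_upper bdd)
  obtain e :: 'a where e: "e \<in> sphere 0 1" using ne by blast
  have sym: "radial_dist A B = radial_dist B A" for A B :: "'a set"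
    by (simp add: radial_dist_def abs_minus_commute)
  have nonneg: "0 \<le> radial_dist A B" for A B :: "'a set"
  proof (cases "A \<in> bounded_star_bodies \<and> B \<in> bounded_star_bodies")
    case True
    then show ?thesis using upper[of A B e] e by linarith
  qed (auto simp: radial_dist_def)
  show ?thesis
  proof
    fix A B C :: "'a set"
    show "0 \<le> radial_dist A B" by (rule nonneg)
    show "radial_dist A B = radial_dist B A" by (rule sym)
    show "radial_dist A B = 0 \<longleftrightarrow> A = B" if AB: "A \<in> bounded_star_bodies" "B \<in> bounded_star_bodies"
    proof
      assume "A = B"
      then show "radial_dist A B = 0" using ne by (simp add: radial_dist_def)
    next
      assume 0: "radial_dist A B = 0"
      have "radial_fun A \<theta> = radial_fun B \<theta>" if th: "\<theta> \<in> sphere 0 1" for \<theta>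
      proof -
        have "radial_fun A \<theta> < top" "radial_fun B \<theta> < top"
          using bounded_star_body_radial_fun[OF AB(1)] bounded_star_body_radial_fun[OF AB(2)] th
          by (meson ennreal_less_top order_le_less_trans)+
        moreover have "enn2real (radial_fun A \<theta>) = enn2real (radial_fun B \<theta>)"
          using upper[OF AB th] 0 by linarith
        ultimately show ?thesis by (metis ennreal_enn2real)
      qed
      then have "x \<in> A \<longleftrightarrow> x \<in> B" for x
        using mem_star_body_sgn[of A x] mem_star_body_sgn[of B x] AB
        by (cases "x = 0") (auto simp: norm_sgn bounded_star_bodies_def)
      then show "A = B" by blast
    qed
    show "radial_dist A C \<le> radial_dist A B + radial_dist B C"
      if "A \<in> bounded_star_bodies" "B \<in> bounded_star_bodies" "C \<in> bounded_star_bodies"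
      using SUP_abs_diff_triangle[OF ne bdd bdd] that by (simp add: radial_dist_def)
  qed
qed

end

theory Submission
  imports Defs
begin

text \<open>On the ray through a unit vector \<open>\<theta>\<close> the radial distance of \<open>l \<theta>\<close> to \<open>A\<close> is
  \<open>l - min l (\<rho>\<^sub>A \<theta>)\<close>, and \<open>min l\<close> is a 1-Lipschitz function of \<open>min j\<close> for \<open>l \<le> j\<close>. Hence the
  supremum over the ball of radius \<open>j\<close> in \<open>dist_AWr\<close> is the uniform distance of the radial
  functions truncated at height \<open>j\<close>, and \<open>dist_AWr\<close> metrizes uniform convergence of all truncations.
  Completeness, closedness under uniform limits and the comparison with \<open>radial_dist\<close> near a
  bounded body (where a high truncation has no effect) follow from this.\<close>

section \<open>Truncated radial functions\<close>

text \<open>Real-valued, so that differences and uniform limits are taken in \<open>real\<close>;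
  \<open>enn2real\<close> loses nothing because the minimum is finite.\<close>

definition radial_trunc :: "real \<Rightarrow> 'a::euclidean_space set \<Rightarrow> 'a \<Rightarrow> real" where
  "radial_trunc r A \<theta> = enn2real (min (ennreal r) (radial_fun A \<theta>))"

lemma ennreal_radial_trunc: "ennreal (radial_trunc r A \<theta>) = min (ennreal r) (radial_fun A \<theta>)"
  unfolding radial_trunc_def by (rule ennreal_enn2real) (simp add: min_less_iff_disj)

lemma radial_trunc_top: "radial_fun A \<theta> = \<infinity> \<Longrightarrow> 0 \<le> r \<Longrightarrow> radial_trunc r A \<theta> = r"
  by (simp add: radial_trunc_def min_def)

lemma radial_trunc_finite:
  assumes "radial_fun A \<theta> < \<infinity>" "0 \<le> r"
  shows "radial_trunc r A \<theta> = min r (enn2real (radial_fun A \<theta>))"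
  using assms by (cases "radial_fun A \<theta>") (auto simp: radial_trunc_def min_def)

text \<open>\<open>enn2real\<close> jumps at infinity, but the minimum stays below
  \<open>ennreal c\<close>, where it is continuous. The general filter serves limits of sequences of
  bodies and continuity in the direction alike.\<close>

lemma tendsto_enn2real_min:
  assumes "(u \<longlongrightarrow> l) F"
  shows "((\<lambda>x. enn2real (min (ennreal c) (u x))) \<longlongrightarrow> enn2real (min (ennreal c) l)) F"
proof (rule tendsto_enn2real)
  have "ennreal (enn2real (min (ennreal c) l)) = min (ennreal c) l"
    by (rule ennreal_enn2real) (simp add: min_less_iff_disj)
  then show "((\<lambda>x. min (ennreal c) (u x)) \<longlongrightarrow> ennreal (enn2real (min (ennreal c) l))) F"
    using tendsto_min[OF tendsto_const assms, of "ennreal c"] by simp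
qed simp

lemma radial_trunc_trunc:
  assumes "0 \<le> r" "r \<le> s"
  shows "radial_trunc r A \<theta> = min r (radial_trunc s A \<theta>)"
proof (cases "radial_fun A \<theta> = \<infinity>")
  case True
  then show ?thesis using assms by (simp add: radial_trunc_top)
next
  case False
  then show ?thesis using assms by (simp add: radial_trunc_finite less_top)
qed

section \<open>Truncations against the radial Attouch-Wets distance\<close>

text \<open>Adding the ball raises the radial function by \<alpha>, so
  \<open>l *\<^sub>R \<theta>\<close> is reached exactly when \<open>l\<close> is at most
  \<open>radial_fun A \<theta>\<close> plus \<alpha>; the infimum over such positive \<alpha> is the
  positive part of the gap.\<close>

lemma radial_infdist_scaleR:
  assumes th: "\<theta> \<in> sphere 0 1" and l: "0 \<le> l"
  shows "radial_infdist (l *\<^sub>R \<theta>) A = l - radial_trunc l A \<theta>"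
proof (cases "l = 0")
  case True
  then show ?thesis
    using radial_infdist_bounds[of 0 A] by (simp add: radial_trunc_def)
next
  case False
  with l have l0: "0 < l" by simp
  have th0: "\<theta> \<noteq> 0" and n: "norm \<theta> = 1" using th by auto
  have sg: "sgn (l *\<^sub>R \<theta>) = \<theta>" "norm (l *\<^sub>R \<theta>) = l" "l *\<^sub>R \<theta> \<noteq> 0"
    using l0 th0 n by (simp_all add: sgn_scaleR sgn_div_norm)
  have S: "{\<alpha>. 0 < \<alpha> \<and> l *\<^sub>R \<theta> \<in> radial_sum A ((\<lambda>y. \<alpha> *\<^sub>R y) ` cball 0 1)}
      = {\<alpha>. 0 < \<alpha> \<and> ennreal l \<le> radial_fun A \<theta> + ennreal \<alpha>}"
    using mem_radial_sum_ball[of _ "l *\<^sub>R \<theta>" A] sg by auto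
  show ?thesis
  proof (cases "radial_fun A \<theta> = \<infinity>")
    case True
    then have "{\<alpha>. 0 < \<alpha> \<and> ennreal l \<le> radial_fun A \<theta> + ennreal \<alpha>} = {0<..}" by auto
    then show ?thesis
      using True l by (simp add: radial_infdist_def S radial_trunc_top)
  next
    case False
    define r where "r = enn2real (radial_fun A \<theta>)"
    have r: "radial_fun A \<theta> = ennreal r" "0 \<le> r"
      using False by (simp_all add: r_def less_top)
    have iff: "ennreal l \<le> radial_fun A \<theta> + ennreal \<alpha> \<longleftrightarrow> l \<le> r + \<alpha>" if "0 < \<alpha>" for \<alpha>
      using that r by (simp flip: ennreal_plus)
    have t: "radial_trunc l A \<theta> = min l r"
      using False l by (simp add: radial_trunc_finite r_def less_top)
    show ?thesis
    \<comment> \<open>Since \<alpha> must be positive, the admissible set is the closed half-line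
      from \<open>l - r\<close> in one case and the open half-line from 0 in the other.\<close>
    proof (cases "r < l")
      case True
      then have "{\<alpha>. 0 < \<alpha> \<and> ennreal l \<le> radial_fun A \<theta> + ennreal \<alpha>} = {l - r..}"
        using iff by fastforce
      then show ?thesis using True by (simp add: radial_infdist_def S t)
    next
      case F: False
      then have "{\<alpha>. 0 < \<alpha> \<and> ennreal l \<le> radial_fun A \<theta> + ennreal \<alpha>} = {0<..}"
        using iff by fastforce
      then show ?thesis using F by (simp add: radial_infdist_def S t)
    qed
  qed
qed

text \<open>A distance below the cap \<open>1 / real j\<close> forces the minimum in term
  \<open>j\<close> to be the supremum, which is then evaluated at the boundary point
  \<open>real j *\<^sub>R \<theta>\<close>.\<close>

lemma radial_trunc_le_dist_AWr:
  assumes j: "1 \<le> j" and d: "dist_AWr A B < 1 / real j" and th: "\<theta> \<in> sphere 0 1"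
  shows "\<bar>radial_trunc (real j) A \<theta> - radial_trunc (real j) B \<theta>\<bar> \<le> dist_AWr A B"
proof -
  let ?D = "\<lambda>j. SUP x\<in>cball 0 (real j). \<bar>radial_infdist x A - radial_infdist x B\<bar>"
  have "min (1 / real j) (?D j) \<le> dist_AWr A B"
    unfolding dist_AWr_def using j
    by (intro cSUP_upper bdd_aboveI2[of _ _ 1]) (auto simp: min_le_iff_disj)
  with d have "?D j \<le> dist_AWr A B" by linarith
  moreover have "\<bar>radial_infdist (real j *\<^sub>R \<theta>) A - radial_infdist (real j *\<^sub>R \<theta>) B\<bar> \<le> ?D j"
    using th by (intro cSUP_upper bdd_above_radial_infdist_diff) auto
  ultimately show ?thesis using th by (simp add: radial_infdist_scaleR)
qed

text \<open>One height suffices: terms with \<open>j \<le> k\<close> only involve truncations up to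
  height \<open>k\<close>, and later terms are capped by \<open>1 / real j\<close>, which is below
  \<open>1 / real k\<close>.\<close>

lemma dist_AWr_le:
  fixes A B :: "'a::euclidean_space set"
  assumes k: "1 \<le> k" "1 / real k \<le> e"
    and T: "\<And>\<theta>. \<theta> \<in> sphere 0 1 \<Longrightarrow> \<bar>radial_trunc (real k) A \<theta> - radial_trunc (real k) B \<theta>\<bar> \<le> e"
  shows "dist_AWr A B \<le> e"
  unfolding dist_AWr_def
proof (rule cSUP_least)
  fix j :: nat assume "j \<in> {1..}"
  show "min (1 / real j) (SUP x\<in>cball 0 (real j). \<bar>radial_infdist x A - radial_infdist x B\<bar>) \<le> e"
  proof (cases "j \<le> k")
    case True
    have "(SUP x\<in>cball 0 (real j). \<bar>radial_infdist x A - radial_infdist x B\<bar>) \<le> e"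
    proof (rule cSUP_least)
      fix x :: 'a assume "x \<in> cball 0 (real j)"
      then have n: "norm x \<le> real k" using True by auto
      have e: "0 \<le> e" using k by (meson divide_nonneg_nonneg of_nat_0_le_iff order_trans zero_le_one)
      show "\<bar>radial_infdist x A - radial_infdist x B\<bar> \<le> e"
      proof (cases "x = 0")
        case True
        then show ?thesis
          using e radial_infdist_bounds[of 0 A] radial_infdist_bounds[of 0 B] by simp
      next
        case False
        then have s: "sgn x \<in> sphere 0 1" "x = norm x *\<^sub>R sgn x"
          by (simp_all add: norm_sgn sgn_div_norm)
        \<comment> \<open>The terms \<open>norm x\<close> cancel, leaving the 1-Lipschitz map
          \<open>min (norm x)\<close> applied to the truncations at height \<open>k\<close>.\<close>
        have "\<bar>radial_infdist (norm x *\<^sub>R sgn x) A - radial_infdist (norm x *\<^sub>R sgn x) B\<bar>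
            \<le> \<bar>radial_trunc (real k) A (sgn x) - radial_trunc (real k) B (sgn x)\<bar>"
          unfolding radial_infdist_scaleR[OF s(1) norm_ge_zero] radial_trunc_trunc[OF norm_ge_zero n]
          by (auto simp: min_def)
        with T[OF s(1)] s(2) show ?thesis by simp
      qed
    qed simp
    then show ?thesis by simp
  next
    case False
    then have "1 / real j \<le> 1 / real k" using k by (simp add: field_simps)
    then show ?thesis using k by simp
  qed
qed simp

section \<open>Completeness\<close>

text \<open>The candidate limit takes in each direction a cluster value of the radial functions; the
  Cauchy property upgrades this pointwise choice to uniform convergence of all truncations.\<close>

lemma mcomplete_star_bodies:
  "Metric_space.mcomplete (star_bodies :: 'a::euclidean_space set set) dist_AWr"
proof -
  interpret Metric_space "star_bodies :: 'a set set" dist_AWr by (rule Metric_space_dist_AWr)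
  show ?thesis
    unfolding mcomplete_def
  proof (intro allI impI)
    fix \<sigma> :: "nat \<Rightarrow> 'a set" assume C: "MCauchy \<sigma>"
    \<comment> \<open>Sequential compactness of \<open>ennreal\<close>: each direction gets its own
      subsequence.\<close>
    have "\<exists>l r. strict_mono r \<and> ((\<lambda>n. radial_fun (\<sigma> n) \<theta>) \<circ> r) \<longlonglongrightarrow> l" for \<theta>
      using compact_complete_linorder by blast
    then obtain f r where r: "\<And>\<theta>. strict_mono (r \<theta>)"
      and f: "\<And>\<theta>. ((\<lambda>n. radial_fun (\<sigma> n) \<theta>) \<circ> r \<theta>) \<longlonglongrightarrow> f \<theta>"
      by metis
    obtain A where A: "A \<in> star_bodies" "\<And>\<theta>. \<theta> \<in> sphere 0 1 \<Longrightarrow> radial_fun A \<theta> = f \<theta>"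
      using ex_star_body[of f] by blast
    have lim: "(\<lambda>n. radial_trunc c (\<sigma> (r \<theta> n)) \<theta>) \<longlonglongrightarrow> radial_trunc c A \<theta>" 
      if "\<theta> \<in> sphere 0 1" for c \<theta>
      unfolding radial_trunc_def A(2)[OF that]
      using f[of \<theta>] by (intro tendsto_enn2real_min) (simp add: o_def)
    have "limitin mtopology \<sigma> A sequentially"
      unfolding limitin_metric
    proof (intro conjI allI impI A)
      fix e :: real assume e: "0 < e"
      then obtain k where k: "1 \<le> k" "1 / real k \<le> e / 2"
        by (metis half_gt_zero inverse_eq_divide less_imp_le One_nat_def reals_Archimedean Suc_le_eq zero_less_Suc)
      obtain N where N: "\<And>n m. N \<le> n \<Longrightarrow> N \<le> m \<Longrightarrow> dist_AWr (\<sigma> n) (\<sigma> m) < 1 / real k"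
        using C k unfolding MCauchy_def
        by (metis divide_pos_pos of_nat_0_less_iff less_le_trans zero_less_one)
      have "dist_AWr (\<sigma> n) A \<le> e / 2" if n: "N \<le> n" for n
      proof (rule dist_AWr_le[OF k])
        fix \<theta> :: 'a assume th: "\<theta> \<in> sphere 0 1"
        \<comment> \<open>With \<open>n\<close> fixed, \<open>m\<close> will tend to infinity along
          the subsequence for \<theta>; \<open>N\<close> is the same for all directions, so the
          limiting bound is uniform.\<close>
        have "\<bar>radial_trunc (real k) (\<sigma> n) \<theta> - radial_trunc (real k) (\<sigma> (r \<theta> m)) \<theta>\<bar> \<le> e / 2"
          if "N \<le> m" for m
        proof -
          have "N \<le> r \<theta> m" using that seq_suble[OF r, of m \<theta>] by simp
          with N n have "dist_AWr (\<sigma> n) (\<sigma> (r \<theta> m)) < 1 / real k" by blast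
          from radial_trunc_le_dist_AWr[OF k(1) this th] this k(2) show ?thesis by linarith
        qed
        then show "\<bar>radial_trunc (real k) (\<sigma> n) \<theta> - radial_trunc (real k) A \<theta>\<bar> \<le> e / 2"
          by (intro tendsto_upperbound[OF tendsto_rabs[OF tendsto_diff[OF tendsto_const lim[OF th]]]])
             (auto simp: eventually_sequentially)
      qed
      moreover have "\<sigma> n \<in> star_bodies" for n using C by (auto simp: MCauchy_def)
      ultimately show "\<forall>\<^sub>F n in sequentially. \<sigma> n \<in> star_bodies \<and> dist_AWr (\<sigma> n) A < e"
        using e unfolding eventually_sequentially
        by (metis field_sum_of_halves less_add_same_cancel1 half_gt_zero le_less_trans)
    qed
    then show "\<exists>x. limitin mtopology \<sigma> x sequentially" by blast
  qed
qed

section \<open>Closedness of the family with continuous radial function\<close>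

text \<open>In the order topology each strict inequality at \<open>x\<close> is already visible at a
  finite height: one above \<open>a\<close> for a lower bound, one above \<open>f x\<close> for an
  upper bound.\<close>

lemma continuous_on_ennreal_truncI:
  fixes f :: "'a::topological_space \<Rightarrow> ennreal"
  assumes "\<And>j::nat. 1 \<le> j \<Longrightarrow> continuous_on S (\<lambda>x. min (of_nat j) (f x))"
  shows "continuous_on S f"
  unfolding continuous_on_def
proof (intro ballI order_tendstoI)
  fix x a assume x: "x \<in> S"
  have T: "((\<lambda>y. min (of_nat j) (f y)) \<longlongrightarrow> min (of_nat j) (f x)) (at x within S)" if "1 \<le> j" for j
    using assms[OF that] x by (simp add: continuous_on_def)
  have ex: "\<exists>j::nat. 1 \<le> j \<and> z < of_nat j" if z: "z < top" for z :: ennreal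
  proof -
    obtain n where n: "z < of_nat n" using ennreal_Ex_less_of_nat[OF z] by blast
    then have "z < of_nat (Suc n)" by (rule less_le_trans) (simp add: of_nat_mono del: of_nat_Suc)
    then show ?thesis by (intro exI[of _ "Suc n"]) simp
  qed
  show "\<forall>\<^sub>F y in at x within S. a < f y" if a: "a < f x"
  proof -
    obtain j where j: "1 \<le> j" "a < of_nat j" using ex[of a] a by (metis top.not_eq_extremum not_top_less)
    have "\<forall>\<^sub>F y in at x within S. a < min (of_nat j) (f y)"
      using order_tendstoD(1)[OF T[OF j(1)]] j a by simp
    then show ?thesis by (rule eventually_mono) simp
  qed
  show "\<forall>\<^sub>F y in at x within S. f y < a" if a: "f x < a"
  proof -
    obtain j where j: "1 \<le> j" "f x < of_nat j" using ex[of "f x"] a by (metis top.not_eq_extremum not_top_less)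
    \<comment> \<open>Cutting \<open>a\<close> at \<open>j\<close> too makes the inequality
      transfer: it forces \<open>f y < a\<close> on whichever side of \<open>j\<close> the value
      \<open>a\<close> lies.\<close>
    have "\<forall>\<^sub>F y in at x within S. min (of_nat j) (f y) < min (of_nat j) a"
      by (rule order_tendstoD(2)[OF T[OF j(1)]]) (use j a in simp)
    then show ?thesis by (rule eventually_mono) (auto simp: min_def split: if_splits)
  qed
qed

text \<open>The uniform limit theorem applies height by height to the truncations, and all heights
  together give continuity of the limit.\<close>

lemma closedin_continuous_star_bodies:
  "closedin (Metric_space.mtopology star_bodies dist_AWr)
     (continuous_star_bodies :: 'a::euclidean_space set set)"
proof -
  interpret Metric_space "star_bodies :: 'a set set" dist_AWr by (rule Metric_space_dist_AWr)
  show ?thesis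
    unfolding metric_closedin_iff_sequentially_closed
  proof (intro conjI allI impI)
    show "continuous_star_bodies \<subseteq> (star_bodies :: 'a set set)"
      by (auto simp: continuous_star_bodies_def)
    fix \<sigma> and A :: "'a set"
    assume "range \<sigma> \<subseteq> continuous_star_bodies \<and> limitin mtopology \<sigma> A sequentially"
    then have A: "A \<in> star_bodies"
      and c: "\<And>n. continuous_on (sphere 0 1) (radial_fun (\<sigma> n))"
      and lim: "\<And>e. 0 < e \<Longrightarrow> \<forall>\<^sub>F n in sequentially. dist_AWr (\<sigma> n) A < e"
      by (auto simp: continuous_star_bodies_def limitin_metric elim: eventually_mono)
    have "continuous_on (sphere 0 1) (\<lambda>\<theta>. min (of_nat j) (radial_fun A \<theta>))" if j: "1 \<le> j" for j
    proof -
      have "continuous_on (sphere 0 1) (radial_trunc (real j) A)"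
      proof (rule uniform_limit_theorem)
        show "\<forall>\<^sub>F n in sequentially. continuous_on (sphere 0 1) (radial_trunc (real j) (\<sigma> n))"
          unfolding radial_trunc_def
          using c by (simp add: continuous_on_def tendsto_enn2real_min)
        show "uniform_limit (sphere 0 1) (\<lambda>n. radial_trunc (real j) (\<sigma> n)) (radial_trunc (real j) A) sequentially"
          unfolding uniform_limit_iff
        proof (intro allI impI)
          fix e :: real assume "0 < e"
          \<comment> \<open>Below \<open>1 / real j\<close> the distance bounds the truncations at
            height \<open>j\<close>; below \<open>e\<close> it gives the accuracy.\<close>
          then have "0 < min (1 / real j) e" using j by simp
          from lim[OF this]
          show "\<forall>\<^sub>F n in sequentially. \<forall>\<theta>\<in>sphere 0 1.
              dist (radial_trunc (real j) (\<sigma> n) \<theta>) (radial_trunc (real j) A \<theta>) < e"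
          proof (rule eventually_mono)
            fix n assume "dist_AWr (\<sigma> n) A < min (1 / real j) e"
            then show "\<forall>\<theta>\<in>sphere 0 1.
                dist (radial_trunc (real j) (\<sigma> n) \<theta>) (radial_trunc (real j) A \<theta>) < e"
              unfolding dist_real_def using radial_trunc_le_dist_AWr[OF j, of "\<sigma> n" A]
              by (metis le_less_trans min_less_iff_conj)
          qed
        qed
      qed simp
      then have "continuous_on (sphere 0 1) (\<lambda>\<theta>. ennreal (radial_trunc (real j) A \<theta>))"
        by (rule continuous_on_ennreal)
      then show ?thesis by (simp add: ennreal_radial_trunc ennreal_of_nat_eq_real_of_nat)
    qed
    then show "A \<in> continuous_star_bodies"
      using A by (auto simp: continuous_star_bodies_def intro: continuous_on_ennreal_truncI)
  qed
qed

section \<open>Openness of the bounded bodies\<close>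

text \<open>Converse of \<open>bounded_star_body_radial_fun\<close>: the norm of a nonzero point of
  \<open>A\<close> is at most the radial function in its direction.\<close>

lemma bounded_star_bodyI:
  assumes A: "A \<in> star_bodies" and R: "\<And>\<theta>. \<theta> \<in> sphere 0 1 \<Longrightarrow> radial_fun A \<theta> \<le> ennreal R"
  shows "A \<in> bounded_star_bodies"
proof -
  have "norm x \<le> max R 0" if "x \<in> A" for x
  proof (cases "x = 0")
    case False
    then have "ennreal (norm x) \<le> ennreal R"
      using that R[of "sgn x"] by (force simp: mem_star_body_sgn[OF A] norm_sgn)
    then show ?thesis using False by (auto simp: ennreal_le_iff2 le_max_iff_disj)
  qed simp
  then show ?thesis
    using A unfolding bounded_star_bodies_def bounded_iff by blast
qed

text \<open>Near a bounded body, \<open>dist_AWr\<close> controls the whole radial function: a truncated value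
  below the truncation level is the actual value.\<close>

lemma bounded_star_body_near:
  assumes A: "A \<in> bounded_star_bodies"
  obtains r where "0 < r"
    "\<And>B \<theta>. dist_AWr A B < r \<Longrightarrow> \<theta> \<in> sphere 0 1 \<Longrightarrow> radial_fun B \<theta> \<le> ennreal (1 / r) \<and>
       \<bar>enn2real (radial_fun A \<theta>) - enn2real (radial_fun B \<theta>)\<bar> \<le> dist_AWr A B"
proof -
  obtain R where R: "0 \<le> R" "\<And>\<theta>. \<theta> \<in> sphere 0 1 \<Longrightarrow> radial_fun A \<theta> \<le> ennreal R"
    using bounded_star_body_radial_fun[OF A] by blast
  \<comment> \<open>A distance below \<open>1 / real j \<le> 1\<close> moves truncated values from
    at most \<open>R\<close> to below \<open>R + 1 < real j\<close>, so those of \<open>B\<close>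
    stay strictly under the level and are exact.\<close>
  obtain j :: nat where j: "R + 1 < real j" using reals_Archimedean2 by blast
  then have j1: "1 \<le> j" using R by linarith
  have "radial_fun B \<theta> \<le> ennreal (real j) \<and>
      \<bar>enn2real (radial_fun A \<theta>) - enn2real (radial_fun B \<theta>)\<bar> \<le> dist_AWr A B"
    if d: "dist_AWr A B < 1 / real j" and th: "\<theta> \<in> sphere 0 1" for B \<theta>
  proof -
    have T: "\<bar>radial_trunc (real j) A \<theta> - radial_trunc (real j) B \<theta>\<bar> \<le> dist_AWr A B"
      by (rule radial_trunc_le_dist_AWr[OF j1 d th])
    have a: "radial_fun A \<theta> < \<infinity>" using R(2)[OF th] by (metis ennreal_less_top infinity_ennreal_def le_less_trans)
    have "enn2real (radial_fun A \<theta>) \<le> R" using R th by (intro enn2real_leI) auto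
    then have tA: "radial_trunc (real j) A \<theta> = enn2real (radial_fun A \<theta>)" and
      "radial_trunc (real j) A \<theta> \<le> R"
      using a j R by (simp_all add: radial_trunc_finite)
    moreover have "1 / real j \<le> 1" using j1 by simp
    ultimately have l: "radial_trunc (real j) B \<theta> < real j" using T d j by linarith
    then have b: "radial_fun B \<theta> < \<infinity>" by (cases "radial_fun B \<theta> = \<infinity>") (auto simp: radial_trunc_top less_top)
    then have tB: "radial_trunc (real j) B \<theta> = enn2real (radial_fun B \<theta>)"
      using l by (simp add: radial_trunc_finite)
    have "radial_fun B \<theta> = ennreal (enn2real (radial_fun B \<theta>))" using b by simp
    then have "radial_fun B \<theta> \<le> ennreal (real j)" using l tB by (metis ennreal_leI less_imp_le)
    then show ?thesis using T tA tB by simp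
  qed
  then show ?thesis using that[of "1 / real j"] j1 by simp
qed

lemma openin_bounded_star_bodies:
  "openin (Metric_space.mtopology star_bodies dist_AWr)
     (bounded_star_bodies :: 'a::euclidean_space set set)"
proof -
  interpret Metric_space "star_bodies :: 'a set set" dist_AWr by (rule Metric_space_dist_AWr)
  show ?thesis
    unfolding openin_mtopology
  proof (intro conjI allI impI)
    show "bounded_star_bodies \<subseteq> (star_bodies :: 'a set set)"
      by (auto simp: bounded_star_bodies_def)
    fix A :: "'a set" assume "A \<in> bounded_star_bodies"
    then obtain r where r: "0 < r"
      "\<And>B \<theta>. dist_AWr A B < r \<Longrightarrow> \<theta> \<in> sphere 0 1 \<Longrightarrow> radial_fun B \<theta> \<le> ennreal (1 / r)"
      by (metis bounded_star_body_near)
    have "mball A r \<subseteq> bounded_star_bodies"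
    proof
      fix B assume "B \<in> mball A r"
      then have "B \<in> star_bodies" "dist_AWr A B < r" by auto
      then show "B \<in> bounded_star_bodies" using r(2) by (intro bounded_star_bodyI)
    qed
    with r show "\<exists>r>0. mball A r \<subseteq> bounded_star_bodies" by blast
  qed
qed

section \<open>Comparison with the radial metric\<close>

lemma enn2real_radial_fun_le_radial_dist:
  assumes "A \<in> bounded_star_bodies" "B \<in> bounded_star_bodies" and th: "\<theta> \<in> sphere 0 1"
  shows "\<bar>enn2real (radial_fun A \<theta>) - enn2real (radial_fun B \<theta>)\<bar> \<le> radial_dist A B"
proof -
  obtain R where R: "0 \<le> R" "\<And>\<theta>. \<theta> \<in> sphere 0 1 \<Longrightarrow> radial_fun A \<theta> \<le> ennreal R"
    using bounded_star_body_radial_fun[OF assms(1)] by blast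
  obtain Q where Q: "0 \<le> Q" "\<And>\<theta>. \<theta> \<in> sphere 0 1 \<Longrightarrow> radial_fun B \<theta> \<le> ennreal Q"
    using bounded_star_body_radial_fun[OF assms(2)] by blast
  have "bdd_above ((\<lambda>\<theta>. \<bar>enn2real (radial_fun A \<theta>) - enn2real (radial_fun B \<theta>)\<bar>) ` sphere 0 1)"
  proof (rule bdd_aboveI2)
    fix \<theta> :: 'a assume "\<theta> \<in> sphere 0 1"
    then have "enn2real (radial_fun A \<theta>) \<le> R" "enn2real (radial_fun B \<theta>) \<le> Q"
      using R Q by (auto intro!: enn2real_leI)
    then show "\<bar>enn2real (radial_fun A \<theta>) - enn2real (radial_fun B \<theta>)\<bar> \<le> R + Q"
      using enn2real_nonneg[of "radial_fun A \<theta>"] enn2real_nonneg[of "radial_fun B \<theta>"] by linarith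
  qed
  then show ?thesis using assms by (auto simp: radial_dist_def intro!: cSUP_upper)
qed

text \<open>Truncation is 1-Lipschitz at every height. The slack \<open>e\<close> leaves room for a
  \<open>k\<close> with \<open>1 / real k\<close> under the bound, even when the radial distance is
  0.\<close>

lemma dist_AWr_le_radial_dist:
  fixes A B :: "'a::euclidean_space set"
  assumes "A \<in> bounded_star_bodies" "B \<in> bounded_star_bodies"
  shows "dist_AWr A B \<le> radial_dist A B"
proof (rule field_le_epsilon)
  fix e :: real assume e: "0 < e"
  interpret Metric_space "bounded_star_bodies :: 'a set set" radial_dist
    by (rule Metric_space_radial_dist)
  obtain k where k: "1 \<le> k" "1 / real k \<le> e"
    using e by (metis inverse_eq_divide less_imp_le One_nat_def reals_Archimedean Suc_le_eq zero_less_Suc)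
  show "dist_AWr A B \<le> radial_dist A B + e"
  proof (rule dist_AWr_le[OF k(1)])
    show "1 / real k \<le> radial_dist A B + e" using k nonneg[of A B] by linarith
    fix \<theta> :: 'a assume th: "\<theta> \<in> sphere 0 1"
    have fin: "radial_fun C \<theta> < \<infinity>" if "C \<in> bounded_star_bodies" for C
      using bounded_star_body_radial_fun[OF that] th
      by (metis ennreal_less_top infinity_ennreal_def le_less_trans)
    have "\<bar>radial_trunc (real k) A \<theta> - radial_trunc (real k) B \<theta>\<bar>
        \<le> \<bar>enn2real (radial_fun A \<theta>) - enn2real (radial_fun B \<theta>)\<bar>"
      using fin[OF assms(1)] fin[OF assms(2)] by (auto simp: radial_trunc_finite min_def)
    with enn2real_radial_fun_le_radial_dist[OF assms th] e
    show "\<bar>radial_trunc (real k) A \<theta> - radial_trunc (real k) B \<theta>\<bar> \<le> radial_dist A B + e"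
      by linarith
  qed
qed

text \<open>Each ball of one metric contains a concentric ball of the other: with equal radii in one
  direction, with a radius depending on the centre \<open>A\<close> in the other.\<close>

lemma mtopology_dist_AWr_eq_radial_dist:
  "Metric_space.mtopology (bounded_star_bodies :: 'a::euclidean_space set set) dist_AWr
   = Metric_space.mtopology bounded_star_bodies radial_dist"
proof -
  interpret S: Metric_space "star_bodies :: 'a set set" dist_AWr by (rule Metric_space_dist_AWr)
  interpret W: Metric_space "bounded_star_bodies :: 'a set set" dist_AWr
    by (rule S.subspace) (auto simp: bounded_star_bodies_def)
  interpret D: Metric_space "bounded_star_bodies :: 'a set set" radial_dist
    by (rule Metric_space_radial_dist)
  have 1: "D.mball A r \<subseteq> W.mball A r" for A r
    using dist_AWr_le_radial_dist by (fastforce simp: W.mball_def D.mball_def)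
  have 2: "\<exists>s>0. W.mball A s \<subseteq> D.mball A r" if A: "A \<in> bounded_star_bodies" and r: "0 < r" for A r
  proof -
    obtain s where s: "0 < s" "\<And>B \<theta>. dist_AWr A B < s \<Longrightarrow> \<theta> \<in> sphere 0 1 \<Longrightarrow>
        \<bar>enn2real (radial_fun A \<theta>) - enn2real (radial_fun B \<theta>)\<bar> \<le> dist_AWr A B"
      using A by (metis bounded_star_body_near)
    have "radial_dist A B \<le> dist_AWr A B" if "dist_AWr A B < s" "B \<in> bounded_star_bodies" for B
      using that A s(2)[of B] by (auto simp: radial_dist_def sphere_eq_empty intro!: cSUP_least)
    then have "W.mball A (min s r) \<subseteq> D.mball A r" by fastforce
    with s r show ?thesis by (intro exI[of _ "min s r"]) simp
  qed
  show ?thesis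
    unfolding topology_eq W.openin_mtopology D.openin_mtopology
  proof (intro allI conj_cong refl all_cong imp_cong iffI)
    fix U and A :: "'a set"
    assume U: "U \<subseteq> bounded_star_bodies" "A \<in> U"
    show "\<exists>r>0. D.mball A r \<subseteq> U" if "\<exists>r>0. W.mball A r \<subseteq> U"
      using that 1[of A] by (meson order_trans)
    show "\<exists>r>0. W.mball A r \<subseteq> U" if D: "\<exists>r>0. D.mball A r \<subseteq> U"
    proof -
      obtain r where r: "0 < r" "D.mball A r \<subseteq> U" using D by blast
      have "A \<in> bounded_star_bodies" using U by blast
      from 2[OF this r(1)] r(2) show ?thesis by (meson order_trans)
    qed
  qed
qed

theorem proposition4p5:
  assumes "CARD('n::finite) \<ge> 2"
  shows "closedin (Metric_space.mtopology star_bodies dist_AWr)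
           (continuous_star_bodies :: (real ^ 'n) set set)
       \<and> Metric_space.mcomplete (continuous_star_bodies :: (real ^ 'n) set set) dist_AWr
       \<and> openin (Metric_space.mtopology star_bodies dist_AWr)
           (bounded_star_bodies :: (real ^ 'n) set set)
       \<and> Metric_space.mtopology (bounded_star_bodies :: (real ^ 'n) set set) dist_AWr
         = Metric_space.mtopology bounded_star_bodies radial_dist"
proof -
  interpret Metric_space "star_bodies :: (real ^ 'n) set set" dist_AWr
    by (rule Metric_space_dist_AWr)
  \<comment> \<open>Completeness passes from the whole space to a closed subset.\<close>
  interpret Submetric "star_bodies :: (real ^ 'n) set set" dist_AWr continuous_star_bodies
    by unfold_locales (auto simp: continuous_star_bodies_def)
  show ?thesis
    using closedin_continuous_star_bodies openin_bounded_star_bodies mtopology_dist_AWr_eq_radial_dist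
      closedin_mcomplete_imp_mcomplete[OF closedin_continuous_star_bodies mcomplete_star_bodies]
    by blast
qed

end
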